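(* Let $G$ be a rotor graph (a stopping directed multigraph with a rotor order $\theta$). For any two rotor configurations $\rho,\rho'$ of $G$, we have $\rho\sim\rho'$ if and only if $\rho'$ can be obtained from $\rho$ by a finite sequence of (positive or negative) cycle pushes.
   Context: A directed multigraph $G=(V,A,\mathrm{head},\mathrm{tail})$ (multiple arcs and loops allowed); $A^+(u)$ is the set of arcs with tail $u$; $V_0$ is the set of vertices with $A^+(u)\neq\emptyset$ and $S_0$ the set of sinks (outdegree $0$). $G$ is stopping if from every vertex there is a directed path to a sink. A rotor order is a bijection $\theta:A\to A$ such that for each $u\in V_0$, $\theta$ maps $A^+(u)$ to itself and acts on it as a single cycle; for $C\subseteq V_0$, $\theta_C$ applies $\theta$ on arcs out of vertices of $C$ and is the identity elsewhere. A rotor configuration is a map $\rho:V_0\to A$ with $\rho(u)\in A^+(u)$; $\mathcal{R}$ is their set; $G(\rho)$ is the graph with vertex set $V$ and arc set $\rho(V_0)$. A particle configuration is a map $\sigma:V\to\mathbb{Z}$; $\Sigma$ is their group; a vertex $u$ is identified with the configuration with one particle on $u$. For $u\in V_0$, $\mathrm{routing}^+_u(\rho,\sigma)=(\theta_{\{u\}}\circ\rho,\ \sigma+\mathrm{head}(\rho(u))-u)$; these are commuting bijections of $\mathcal{R}\times\Sigma$ with inverses $\mathrm{routing}^-_u$; for $r:V_0\to\mathbb{Z}$, $\mathrm{routing}^r$ is the composition of the $(\mathrm{routing}^+_u)^{r(u)}$ (negative powers = inverses). $(\rho,\sigma)\sim(\rho',\sigma')$ iff $\mathrm{routing}^r(\rho,\sigma)=(\rho',\sigma')$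 for some $r$; and $\rho\sim\rho'$ iff $(\rho,\sigma)\sim(\rho',\sigma)$ for some $\sigma\in\Sigma$. A positive cycle push: if $C$ is (the vertex set of) a directed circuit in $G(\rho)$, replace $\rho$ by $\theta_C\circ\rho$. A negative cycle push: if $C$ is a directed circuit in $G(\theta^{-1}\circ\rho)$, replace $\rho$ by $\theta_C^{-1}\circ\rho$. *)

theory Defs
  imports "Graph_Theory.Graph_Theory" "HOL-Combinatorics.Orbits" "HOL-Library.FuncSet"
begin

text \<open>
  Directed multigraphs, out-arcs, reachability and circuits are those of the AFP entry
  Graph Theory. Arc circuits there are nonempty closed walks without repeated vertices; a loop
  is a circuit of length one.
\<close>

definition nonsinks :: "('v, 'a) pre_digraph \<Rightarrow> 'v set" where
  "nonsinks G = {u \<in> verts G. out_arcs G u \<noteq> {}}"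

definition sinks :: "('v, 'a) pre_digraph \<Rightarrow> 'v set" where
  "sinks G = {u \<in> verts G. out_arcs G u = {}}"

definition stopping :: "('v, 'a) pre_digraph \<Rightarrow> bool" where
  "stopping G \<longleftrightarrow> (\<forall>u \<in> verts G. \<exists>s \<in> sinks G. u \<rightarrow>\<^sup>*\<^bsub>G\<^esub> s)"

text \<open>
  A bijection of the arc set is represented by its extension by the identity to the whole type,
  so that its inverse is \<^term>\<open>inv \<theta>\<close>.
\<close>

definition rotor_order :: "('v, 'a) pre_digraph \<Rightarrow> ('a \<Rightarrow> 'a) \<Rightarrow> bool" where
  "rotor_order G \<theta> \<longleftrightarrow> \<theta> permutes arcs G \<and>
     (\<forall>u \<in> nonsinks G. \<theta> ` out_arcs G u = out_arcs G u \<and> cyclic_on \<theta> (out_arcs G u))"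

locale rotor_graph = fin_digraph G for G :: "('v, 'a) pre_digraph" +
  fixes \<theta> :: "'a \<Rightarrow> 'a"
  assumes stopping: "stopping G"
    and rotor_order: "rotor_order G \<theta>"

definition theta_on :: "('v, 'a) pre_digraph \<Rightarrow> ('a \<Rightarrow> 'a) \<Rightarrow> 'v set \<Rightarrow> 'a \<Rightarrow> 'a" where
  "theta_on G \<theta> C a = (if a \<in> arcs G \<and> tail G a \<in> C then \<theta> a else a)"

text \<open>
  Functions with a prescribed domain are normalised outside it: rotor configurations are
  \<^term>\<open>undefined\<close> outside \<^term>\<open>nonsinks G\<close> (whence the use of \<^const>\<open>compose\<close>), particle
  configurations are zero outside \<^term>\<open>verts G\<close>.
\<close>

definition rotor_configs :: "('v, 'a) pre_digraph \<Rightarrow> ('v \<Rightarrow> 'a) set" where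
  "rotor_configs G = (\<Pi>\<^sub>E u \<in> nonsinks G. out_arcs G u)"

definition particle_configs :: "('v, 'a) pre_digraph \<Rightarrow> ('v \<Rightarrow> int) set" where
  "particle_configs G = {\<sigma>. \<forall>v. v \<notin> verts G \<longrightarrow> \<sigma> v = 0}"

definition particle :: "'v \<Rightarrow> 'v \<Rightarrow> int" where
  "particle u v = (if v = u then 1 else 0)"

type_synonym ('v, 'a) rp_config = "('v \<Rightarrow> 'a) \<times> ('v \<Rightarrow> int)"

definition rp_configs :: "('v, 'a) pre_digraph \<Rightarrow> ('v, 'a) rp_config set" where
  "rp_configs G = rotor_configs G \<times> particle_configs G"

definition routing_pos ::
  "('v, 'a) pre_digraph \<Rightarrow> ('a \<Rightarrow> 'a) \<Rightarrow> 'v \<Rightarrow> ('v, 'a) rp_config \<Rightarrow> ('v, 'a) rp_config" where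
  "routing_pos G \<theta> u = (\<lambda>(\<rho>, \<sigma>).
     (compose (nonsinks G) (theta_on G \<theta> {u}) \<rho>,
      \<lambda>v. \<sigma> v + particle (head G (\<rho> u)) v - particle u v))"

definition routing_neg ::
  "('v, 'a) pre_digraph \<Rightarrow> ('a \<Rightarrow> 'a) \<Rightarrow> 'v \<Rightarrow> ('v, 'a) rp_config \<Rightarrow> ('v, 'a) rp_config" where
  "routing_neg G \<theta> u = inv_into (rp_configs G) (routing_pos G \<theta> u)"

definition routing_power ::
  "('v, 'a) pre_digraph \<Rightarrow> ('a \<Rightarrow> 'a) \<Rightarrow> 'v \<Rightarrow> int \<Rightarrow> ('v, 'a) rp_config \<Rightarrow> ('v, 'a) rp_config" where
  "routing_power G \<theta> u k =
     (if k \<ge> 0 then routing_pos G \<theta> u ^^ nat k else routing_neg G \<theta> u ^^ nat (- k))"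

text \<open>
  The composition over all non-sinks may be taken in any order because the routings commute on
  \<^term>\<open>rp_configs G\<close>; see \<open>routing_fold_insert\<close> below. Only the values of \<^term>\<open>r\<close> on
  \<^term>\<open>nonsinks G\<close> matter.
\<close>

definition routing ::
  "('v, 'a) pre_digraph \<Rightarrow> ('a \<Rightarrow> 'a) \<Rightarrow> ('v \<Rightarrow> int) \<Rightarrow> ('v, 'a) rp_config \<Rightarrow> ('v, 'a) rp_config" where
  "routing G \<theta> r s = Finite_Set.fold (\<lambda>u. routing_power G \<theta> u (r u)) s (nonsinks G)"

definition rp_equiv ::
  "('v, 'a) pre_digraph \<Rightarrow> ('a \<Rightarrow> 'a) \<Rightarrow> ('v, 'a) rp_config \<Rightarrow> ('v, 'a) rp_config \<Rightarrow> bool" where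
  "rp_equiv G \<theta> s s' \<longleftrightarrow>
     s \<in> rp_configs G \<and> s' \<in> rp_configs G \<and> (\<exists>r. routing G \<theta> r s = s')"

definition rotor_equiv ::
  "('v, 'a) pre_digraph \<Rightarrow> ('a \<Rightarrow> 'a) \<Rightarrow> ('v \<Rightarrow> 'a) \<Rightarrow> ('v \<Rightarrow> 'a) \<Rightarrow> bool" where
  "rotor_equiv G \<theta> \<rho> \<rho>' \<longleftrightarrow> (\<exists>\<sigma> \<in> particle_configs G. rp_equiv G \<theta> (\<rho>, \<sigma>) (\<rho>', \<sigma>))"

definition config_graph :: "('v, 'a) pre_digraph \<Rightarrow> ('v \<Rightarrow> 'a) \<Rightarrow> ('v, 'a) pre_digraph" where
  "config_graph G \<rho> = G\<lparr>arcs := \<rho> ` nonsinks G\<rparr>"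

text \<open>Every vertex of a circuit is the tail of one of its arcs.\<close>

definition circuit_vertices :: "('v, 'a) pre_digraph \<Rightarrow> 'v set \<Rightarrow> bool" where
  "circuit_vertices H C \<longleftrightarrow> (\<exists>p. pre_digraph.cycle H p \<and> C = tail H ` set p)"

definition positive_push ::
  "('v, 'a) pre_digraph \<Rightarrow> ('a \<Rightarrow> 'a) \<Rightarrow> ('v \<Rightarrow> 'a) \<Rightarrow> ('v \<Rightarrow> 'a) \<Rightarrow> bool" where
  "positive_push G \<theta> \<rho> \<rho>' \<longleftrightarrow>
     (\<exists>C. circuit_vertices (config_graph G \<rho>) C \<and>
          \<rho>' = compose (nonsinks G) (theta_on G \<theta> C) \<rho>)"

definition negative_push ::
  "('v, 'a) pre_digraph \<Rightarrow> ('a \<Rightarrow> 'a) \<Rightarrow> ('v \<Rightarrow> 'a) \<Rightarrow> ('v \<Rightarrow> 'a) \<Rightarrow> bool" where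
  "negative_push G \<theta> \<rho> \<rho>' \<longleftrightarrow>
     (\<exists>C. circuit_vertices (config_graph G (compose (nonsinks G) (inv \<theta>) \<rho>)) C \<and>
          \<rho>' = compose (nonsinks G) (inv (theta_on G \<theta> C)) \<rho>)"

definition cycle_push ::
  "('v, 'a) pre_digraph \<Rightarrow> ('a \<Rightarrow> 'a) \<Rightarrow> ('v \<Rightarrow> 'a) \<Rightarrow> ('v \<Rightarrow> 'a) \<Rightarrow> bool" where
  "cycle_push G \<theta> \<rho> \<rho>' \<longleftrightarrow> positive_push G \<theta> \<rho> \<rho>' \<or> negative_push G \<theta> \<rho> \<rho>'"


context rotor_graph
begin

lemma theta_perm: "\<theta> permutes arcs G"
  using rotor_order by (simp add: rotor_order_def)

lemma finite_nonsinks: "finite (nonsinks G)"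
  by (simp add: nonsinks_def)

lemma theta_out_arcs: "u \<in> nonsinks G \<Longrightarrow> \<theta> ` out_arcs G u = out_arcs G u"
  using rotor_order by (simp add: rotor_order_def)

lemma inv_theta_out_arcs: "u \<in> nonsinks G \<Longrightarrow> a \<in> out_arcs G u \<Longrightarrow> inv \<theta> a \<in> out_arcs G u"
  by (metis theta_out_arcs theta_perm permutes_inverses(2) imageE)

lemma config_in: "\<rho> \<in> rotor_configs G \<Longrightarrow> u \<in> nonsinks G \<Longrightarrow> \<rho> u \<in> out_arcs G u"
  by (auto simp: rotor_configs_def)

lemma theta_on_config:
  assumes "\<rho> \<in> rotor_configs G" "u \<in> nonsinks G"
  shows "compose (nonsinks G) (theta_on G \<theta> {u}) \<rho> = \<rho>(u := \<theta> (\<rho> u))"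
proof
  fix w
  show "compose (nonsinks G) (theta_on G \<theta> {u}) \<rho> w = (\<rho>(u := \<theta> (\<rho> u))) w"
  proof (cases "w \<in> nonsinks G")
    case True
    with assms(1) have "\<rho> w \<in> arcs G \<and> tail G (\<rho> w) = w"
      using config_in by fastforce
    then show ?thesis
      using True by (simp add: compose_def theta_on_def)
  next
    case False
    with assms show ?thesis
      by (auto simp: compose_def rotor_configs_def PiE_def extensional_def)
  qed
qed

lemma routing_pos_eq:
  assumes "\<rho> \<in> rotor_configs G" "u \<in> nonsinks G"
  shows "routing_pos G \<theta> u (\<rho>, \<sigma>) =
    (\<rho>(u := \<theta> (\<rho> u)), \<lambda>v. \<sigma> v + particle (head G (\<rho> u)) v - particle u v)"
  by (simp add: routing_pos_def theta_on_config[OF assms])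

lemma config_upd:
  assumes "\<rho> \<in> rotor_configs G" "u \<in> nonsinks G" "a \<in> out_arcs G u"
  shows "\<rho>(u := a) \<in> rotor_configs G"
  using assms by (auto simp: rotor_configs_def PiE_def extensional_def)

lemma particle_upd:
  assumes "u \<in> nonsinks G" "a \<in> out_arcs G u" "\<sigma> \<in> particle_configs G"
  shows "(\<lambda>v. \<sigma> v + particle (head G a) v - particle u v) \<in> particle_configs G"
    "(\<lambda>v. \<sigma> v - particle (head G a) v + particle u v) \<in> particle_configs G"
  using assms by (auto simp: particle_configs_def particle_def nonsinks_def)

lemma routing_pos_bij:
  assumes u: "u \<in> nonsinks G"
  shows "bij_betw (routing_pos G \<theta> u) (rp_configs G) (rp_configs G)"
proof (rule bij_betw_byWitness)
  let ?g = "\<lambda>(\<rho>, \<sigma>). (\<rho>(u := inv \<theta> (\<rho> u)),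
     \<lambda>v. \<sigma> v - particle (head G (inv \<theta> (\<rho> u))) v + particle u v)"
  have th: "\<theta> (\<rho> u) \<in> out_arcs G u" if "\<rho> \<in> rotor_configs G" for \<rho>
    using theta_out_arcs[OF u] config_in[OF that u] by blast
  have ith: "inv \<theta> (\<rho> u) \<in> out_arcs G u" if "\<rho> \<in> rotor_configs G" for \<rho>
    using inv_theta_out_arcs[OF u] config_in[OF that u] by blast
  have iupd: "\<rho>(u := inv \<theta> (\<rho> u)) \<in> rotor_configs G" if "\<rho> \<in> rotor_configs G" for \<rho>
    by (rule config_upd[OF that u ith[OF that]])
  have upd: "\<rho>(u := \<theta> (\<rho> u)) \<in> rotor_configs G" if "\<rho> \<in> rotor_configs G" for \<rho>
    by (rule config_upd[OF that u th[OF that]])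
  show "\<forall>s \<in> rp_configs G. ?g (routing_pos G \<theta> u s) = s"
    by (auto simp: rp_configs_def routing_pos_eq u permutes_inverses[OF theta_perm])
  show "\<forall>s \<in> rp_configs G. routing_pos G \<theta> u (?g s) = s"
    by (auto simp: rp_configs_def routing_pos_eq[OF iupd u] permutes_inverses[OF theta_perm])
  show "routing_pos G \<theta> u ` rp_configs G \<subseteq> rp_configs G"
    by (auto simp: rp_configs_def routing_pos_eq u upd
        particle_upd(1)[OF u config_in[OF _ u]])
  show "?g ` rp_configs G \<subseteq> rp_configs G"
    by (auto simp: rp_configs_def iupd particle_upd(2)[OF u ith])
qed

lemma routing_pos_in: "u \<in> nonsinks G \<Longrightarrow> s \<in> rp_configs G \<Longrightarrow> routing_pos G \<theta> u s \<in> rp_configs G"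
  using routing_pos_bij bij_betwE by blast

lemma routing_neg_in: "u \<in> nonsinks G \<Longrightarrow> s \<in> rp_configs G \<Longrightarrow> routing_neg G \<theta> u s \<in> rp_configs G"
  unfolding routing_neg_def using bij_betw_inv_into[OF routing_pos_bij] bij_betwE by blast

lemma routing_pos_commute:
  assumes "u \<in> nonsinks G" "w \<in> nonsinks G" "s \<in> rp_configs G"
  shows "routing_pos G \<theta> u (routing_pos G \<theta> w s) = routing_pos G \<theta> w (routing_pos G \<theta> u s)"
proof -
  obtain \<rho> \<sigma> where s: "s = (\<rho>, \<sigma>)" by fastforce
  have \<rho>: "\<rho> \<in> rotor_configs G"
    using assms s by (simp add: rp_configs_def)
  have "\<rho>(x := \<theta> (\<rho> x)) \<in> rotor_configs G" if "x \<in> nonsinks G" for x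
    using config_upd[OF \<rho> that] theta_out_arcs[OF that] config_in[OF \<rho> that] by blast
  then show ?thesis
    using assms \<rho> by (cases "u = w") (auto simp: s routing_pos_eq fun_upd_twist fun_eq_iff)
qed

end

lemma commute_inv_into:
  assumes "bij_betw f S S" "\<And>x. x \<in> S \<Longrightarrow> g x \<in> S" "\<And>x. x \<in> S \<Longrightarrow> f (g x) = g (f x)" "x \<in> S"
  shows "inv_into S f (g x) = g (inv_into S f x)"
proof -
  have y: "inv_into S f x \<in> S" "f (inv_into S f x) = x"
    using assms by (auto simp: bij_betw_def inv_into_into f_inv_into_f)
  then have "inv_into S f (g x) = inv_into S f (f (g (inv_into S f x)))"
    using assms(3) by simp
  also have "\<dots> = g (inv_into S f x)"
    using assms(1,2) y(1) by (meson bij_betw_def inv_into_f_f)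
  finally show ?thesis .
qed

lemma funpow_in: "(\<And>x. x \<in> S \<Longrightarrow> f x \<in> S) \<Longrightarrow> x \<in> S \<Longrightarrow> (f ^^ n) x \<in> S"
  by (induction n) auto

lemma commute_funpow:
  assumes "\<And>x. x \<in> S \<Longrightarrow> f x \<in> S" "\<And>x. x \<in> S \<Longrightarrow> f (g x) = g (f x)" "x \<in> S"
  shows "(f ^^ n) (g x) = g ((f ^^ n) x)"
  using funpow_in[of S f, OF assms(1) assms(3)] by (induction n) (simp_all add: assms)

context rotor_graph
begin

lemma routing_power_in:
  "u \<in> nonsinks G \<Longrightarrow> s \<in> rp_configs G \<Longrightarrow> routing_power G \<theta> u k s \<in> rp_configs G"
  by (simp add: routing_power_def funpow_in routing_pos_in routing_neg_in)

lemma routing_power_commute: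
  assumes u: "u \<in> nonsinks G" and w: "w \<in> nonsinks G" and s: "s \<in> rp_configs G"
  shows "routing_power G \<theta> u k (routing_power G \<theta> w l s) =
    routing_power G \<theta> w l (routing_power G \<theta> u k s)"
proof -
  have lift: "routing_power G \<theta> x m (g y) = g (routing_power G \<theta> x m y)"
    if x: "x \<in> nonsinks G" and g: "\<And>z. z \<in> rp_configs G \<Longrightarrow> g z \<in> rp_configs G"
      and c: "\<And>z. z \<in> rp_configs G \<Longrightarrow> routing_pos G \<theta> x (g z) = g (routing_pos G \<theta> x z)"
      and y: "y \<in> rp_configs G" for x m y and g :: "('v, 'a) rp_config \<Rightarrow> ('v, 'a) rp_config"
  proof -
    have "routing_neg G \<theta> x (g z) = g (routing_neg G \<theta> x z)" if "z \<in> rp_configs G" for z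
      unfolding routing_neg_def
      by (rule commute_inv_into[of _ "rp_configs G" g, OF routing_pos_bij[OF x] g c that])
    then show ?thesis
      using commute_funpow[of "rp_configs G" "routing_pos G \<theta> x" g y]
        commute_funpow[of "rp_configs G" "routing_neg G \<theta> x" g y] x y c
      by (simp add: routing_power_def routing_pos_in routing_neg_in)
  qed
  have "routing_pos G \<theta> u (routing_power G \<theta> w l z) = routing_power G \<theta> w l (routing_pos G \<theta> u z)"
    if "z \<in> rp_configs G" for z
    using lift[of w "routing_pos G \<theta> u" z l] routing_pos_commute[OF w u] routing_pos_in[OF u] w that
    by simp
  then show ?thesis
    using lift[of u "routing_power G \<theta> w l" s k] routing_power_in[OF w] u s by simp
qed

lemma routing_fold_insert:
  assumes "finite A" "insert u A \<subseteq> nonsinks G" "u \<notin> A" "s \<in> rp_configs G"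
  shows "Finite_Set.fold (\<lambda>u. routing_power G \<theta> u (r u)) s (insert u A) =
    routing_power G \<theta> u (r u) (Finite_Set.fold (\<lambda>u. routing_power G \<theta> u (r u)) s A)"
proof -
  let ?f = "\<lambda>u. routing_power G \<theta> u (r u)"
  define g where "g u t = (if u \<in> nonsinks G \<and> t \<in> rp_configs G then ?f u t else t)" for u t
  interpret comp_fun_commute g
    by standard (auto simp: g_def fun_eq_iff routing_power_in routing_power_commute)
  have eq: "Finite_Set.fold ?f s B = Finite_Set.fold g s B" if "B \<subseteq> nonsinks G" for B
    by (rule fold_closed_eq[of B "rp_configs G"])
      (use that assms(4) in \<open>auto simp: g_def routing_power_in subset_iff\<close>)
  have "Finite_Set.fold g s A \<in> rp_configs G"
    using assms(1)
  proof (induction A)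
    case (insert x F)
    have "g x t \<in> rp_configs G" if "t \<in> rp_configs G" for t
      using that by (simp add: g_def routing_power_in)
    with insert show ?case by simp
  qed (simp add: assms(4))
  then show ?thesis
    using assms eq[of A] eq[of "insert u A"] by (simp add: g_def)
qed

end

end

theory Submission
  imports Defs
begin

text \<open>
  Writing a routing vector as a difference \<open>n - m\<close> of natural vectors, two rotor configurations
  are equivalent iff firing \<open>n\<close> from one and \<open>m\<close> from the other gives the same rotors and the
  same displacement of particles. A cycle push fires every vertex of a circuit once and displaces
  no particle. Conversely, take \<open>n\<close> and \<open>m\<close> with disjoint supports and let \<open>U\<close> be the support
  of \<open>n\<close>. Firing \<open>n\<close> cannot increase the number of particles in \<open>U\<close>, firing \<open>m\<close> cannot decrease
  it, so no particle leaves \<open>U\<close>. In particular all current rotors of \<open>U\<close> point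
  into \<open>U\<close>, hence they contain a circuit; pushing it decreases \<open>n\<close>, and one concludes by induction.
\<close>

section \<open>Circuits in the graph of a rotor configuration\<close>

lemma (in pre_digraph) tl_awalk_verts_cas: "cas u p v \<Longrightarrow> tl (awalk_verts u p) = map (head G) p"
proof (induction p arbitrary: u)
  case (Cons e es)
  then show ?case by (cases es) auto
qed simp

lemma (in pre_digraph) cycle_iff_cas:
  "cycle p \<longleftrightarrow> p \<noteq> [] \<and> set p \<subseteq> arcs G \<and> (\<exists>u \<in> verts G. cas u p u) \<and> distinct (map (head G) p)"
  unfolding cycle_def awalk_def using tl_awalk_verts_cas by metis

lemma cas_update_arcs: "pre_digraph.cas (G\<lparr>arcs := A\<rparr>) u p v = pre_digraph.cas G u p v"
  by (induction p arbitrary: u) (simp_all add: pre_digraph.cas.simps)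

text \<open>Walk consistency \<open>cas\<close>, heads and vertices do not see the arc set, so only
  the inclusion \<open>set p \<subseteq> A\<close> changes. Circuits can thus be moved between
  graphs on the same vertices without checking well-formedness.\<close>

lemma cycle_update_arcs:
  "pre_digraph.cycle (G\<lparr>arcs := A\<rparr>) p \<longleftrightarrow>
     set p \<subseteq> A \<and> p \<noteq> [] \<and> (\<exists>u \<in> verts G. pre_digraph.cas G u p u) \<and> distinct (map (head G) p)"
  by (auto simp: pre_digraph.cycle_iff_cas cas_update_arcs)

text \<open>Telescoping: the head of each arc is the tail of the next. On a closed walk the sums
  over heads and over tails agree.\<close>

lemma (in pre_digraph) sum_list_head_cas:
  fixes f :: "'a \<Rightarrow> 'c::ab_group_add"
  shows "cas u p v \<Longrightarrow> (\<Sum>a\<leftarrow>p. f (head G a)) + f u = (\<Sum>a\<leftarrow>p. f (tail G a)) + f v"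
proof (induction p arbitrary: u)
  case (Cons e es)
  then have "(\<Sum>a\<leftarrow>es. f (head G a)) + f (head G e) = (\<Sum>a\<leftarrow>es. f (tail G a)) + f v" "tail G e = u"
    by auto
  then show ?case by (simp add: algebra_simps)
qed simp

text \<open>The reversed arc relation on \<open>U\<close> has no minimal element in
  \<open>U\<close>, so it is not well-founded; being finite, it is not acyclic. The resulting closed
  walk contains a circuit.\<close>

lemma (in wf_digraph) cycle_of_no_exit:
  assumes fin: "finite U" and ne: "U \<noteq> {}"
    and step: "\<And>u. u \<in> U \<Longrightarrow> \<exists>v \<in> U. u \<rightarrow>\<^bsub>G\<^esub> v"
  shows "\<exists>p. cycle p"
proof -
  define r where "r = {(v, u). u \<in> U \<and> v \<in> U \<and> u \<rightarrow>\<^bsub>G\<^esub> v}"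
  have "r \<subseteq> U \<times> U" by (auto simp: r_def)
  then have finr: "finite r" using fin by (meson finite_SigmaI finite_subset)
  have "\<not> wf r"
  proof
    assume "wf r"
    then obtain z where z: "z \<in> U" "\<And>y. (y, z) \<in> r \<Longrightarrow> y \<notin> U"
      using ne unfolding wf_eq_minimal by (metis ex_in_conv)
    obtain v where v: "v \<in> U" "z \<rightarrow>\<^bsub>G\<^esub> v" using step[OF z(1)] by blast
    then have "(v, z) \<in> r" using z(1) by (simp add: r_def)
    then show False using z(2) v(1) by blast
  qed
  then have "\<not> acyclic r" using finite_acyclic_wf finr by blast
  then obtain x where "(x, x) \<in> r\<^sup>+" by (auto simp: acyclic_def)
  moreover have "r\<inverse> \<subseteq> arcs_ends G" by (auto simp: r_def)
  ultimately have "(x, x) \<in> (arcs_ends G)\<^sup>+"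
    by (meson converse_iff trancl_converseI trancl_mono)
  then obtain p where "awalk x p x" "p \<noteq> []" by (auto simp: reachable1_awalk)
  then show ?thesis using closed_w_imp_cycle by (auto simp: closed_w_def)
qed

context rotor_graph
begin

lemma tail_config:
  assumes "\<rho> \<in> rotor_configs G" "u \<in> nonsinks G"
  shows "tail G (\<rho> u) = u" "\<rho> u \<in> arcs G"
  using config_in[OF assms] by auto

lemma circuit_vertices_subset:
  assumes "\<rho> \<in> rotor_configs G" "circuit_vertices (config_graph G \<rho>) C"
  shows "C \<subseteq> nonsinks G"
  using assms by (auto simp: circuit_vertices_def config_graph_def cycle_update_arcs tail_config)

text \<open>Each arc of a circuit in the graph of \<open>\<rho>\<close> is the rotor of its own
  tail, so only the rotors on \<open>C\<close> matter.\<close>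

lemma circuit_vertices_transfer:
  assumes \<rho>: "\<rho> \<in> rotor_configs G" and C: "circuit_vertices (config_graph G \<rho>) C"
    and eq: "\<And>u. u \<in> C \<Longrightarrow> \<rho>' u = \<rho> u"
  shows "circuit_vertices (config_graph G \<rho>') C"
proof -
  obtain p where p: "pre_digraph.cycle (config_graph G \<rho>) p" "C = tail G ` set p"
    using C by (auto simp: circuit_vertices_def config_graph_def)
  have sub: "set p \<subseteq> \<rho> ` nonsinks G"
    using p(1) by (simp add: config_graph_def cycle_update_arcs)
  have "set p \<subseteq> \<rho>' ` nonsinks G"
  proof
    fix a assume a: "a \<in> set p"
    then obtain u where u: "u \<in> nonsinks G" "a = \<rho> u" using sub by auto
    then have "u \<in> C" using tail_config[OF \<rho>] p(2) a by (metis imageI)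
    then show "a \<in> \<rho>' ` nonsinks G" using u eq by (metis imageI)
  qed
  then show ?thesis using p
    by (auto simp: circuit_vertices_def config_graph_def cycle_update_arcs)
qed

text \<open>On the arcs of the circuit \<open>tail\<close> is injective, with inverse
  \<open>\<rho>\<close>, so both sums become sums over arcs, which telescope. With \<open>f\<close>
  the indicator of a vertex, this says that firing a circuit once displaces no particle.\<close>

lemma circuit_vertices_sum_head:
  fixes f :: "'v \<Rightarrow> int"
  assumes \<rho>: "\<rho> \<in> rotor_configs G" and C: "circuit_vertices (config_graph G \<rho>) C"
  shows "(\<Sum>u\<in>C. f (head G (\<rho> u))) = (\<Sum>u\<in>C. f u)"
proof -
  obtain p u where p: "C = tail G ` set p" "set p \<subseteq> \<rho> ` nonsinks G" "cas u p u"
      "distinct (map (head G) p)"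
    using C by (auto simp: circuit_vertices_def config_graph_def cycle_update_arcs)
  have val: "\<rho> (tail G a) = a" if "a \<in> set p" for a
    using that p(2) tail_config[OF \<rho>] by auto
  then have inj: "inj_on (tail G) (set p)" by (metis inj_onI)
  have d: "distinct p" using p(4) by (simp add: distinct_map)
  have "(\<Sum>u\<in>C. f (head G (\<rho> u))) = (\<Sum>a\<in>set p. f (head G a))"
    using p(1) val by (simp add: sum.reindex[OF inj])
  also have "\<dots> = (\<Sum>a\<in>set p. f (tail G a))"
    using sum_list_head_cas[OF p(3), of f] d by (simp add: sum_list_distinct_conv_sum_set)
  also have "\<dots> = (\<Sum>u\<in>C. f u)"
    using p(1) by (simp add: sum.reindex[OF inj])
  finally show ?thesis .
qed

lemma ex_circuit_vertices:
  assumes \<rho>: "\<rho> \<in> rotor_configs G" and U: "U \<subseteq> nonsinks G" "U \<noteq> {}"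
    and closed: "\<And>u. u \<in> U \<Longrightarrow> head G (\<rho> u) \<in> U"
  shows "\<exists>C. C \<noteq> {} \<and> C \<subseteq> U \<and> circuit_vertices (config_graph G \<rho>) C"
proof -
  \<comment> \<open>Keeping only the rotors of \<open>U\<close> forces the tails of any circuit of
    \<open>H\<close> to lie in \<open>U\<close>.\<close>
  define H where "H = G\<lparr>arcs := \<rho> ` U\<rparr>"
  have arcs: "\<rho> u \<in> arcs G" "tail G (\<rho> u) = u" if "u \<in> U" for u
    using that U tail_config[OF \<rho>] by auto
  interpret H: wf_digraph H
  proof
    fix e assume "e \<in> arcs H"
    then have "e \<in> arcs G" using arcs by (auto simp: H_def)
    then show "tail H e \<in> verts H" "head H e \<in> verts H" by (simp_all add: H_def)
  qed
  have "finite U" using U finite_nonsinks by (meson finite_subset)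
  moreover have "\<exists>v \<in> U. u \<rightarrow>\<^bsub>H\<^esub> v" if "u \<in> U" for u
    using that closed[OF that] arcs(2)[OF that]
    by (intro bexI[of _ "head G (\<rho> u)"]) (force simp: H_def arcs_ends_conv image_iff)+
  ultimately obtain p where p: "pre_digraph.cycle H p"
    using H.cycle_of_no_exit U(2) by metis
  then have p': "set p \<subseteq> \<rho> ` U" "p \<noteq> []"
    by (simp_all add: H_def cycle_update_arcs)
  then have "set p \<subseteq> \<rho> ` nonsinks G" using U(1) by (meson image_mono order_trans)
  then have "pre_digraph.cycle (config_graph G \<rho>) p"
    using p by (simp add: config_graph_def H_def cycle_update_arcs)
  then have "circuit_vertices (config_graph G \<rho>) (tail G ` set p)"
    by (auto simp: circuit_vertices_def config_graph_def)
  moreover have "tail G ` set p \<subseteq> U" "tail G ` set p \<noteq> {}"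
    using p' arcs(2) by auto
  ultimately show ?thesis by (intro exI[of _ "tail G ` set p"] conjI)
qed

section \<open>Natural routing vectors\<close>

definition fire_rotors :: "('v \<Rightarrow> nat) \<Rightarrow> ('v \<Rightarrow> 'a) \<Rightarrow> 'v \<Rightarrow> 'a" where
  "fire_rotors n \<rho> u = (if u \<in> nonsinks G then (\<theta> ^^ n u) (\<rho> u) else \<rho> u)"

text \<open>The successive firings of \<open>u\<close> use the arcs \<open>\<rho> u\<close>,
  \<open>\<theta> (\<rho> u)\<close>, and so on, whatever is fired elsewhere in between. The
  displacement is therefore a sum over vertices, with no order of firing and no dependence on the
  particles.\<close>

definition gain :: "('v \<Rightarrow> nat) \<Rightarrow> ('v \<Rightarrow> 'a) \<Rightarrow> 'v \<Rightarrow> int" where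
  "gain n \<rho> v =
     (\<Sum>u\<in>nonsinks G. \<Sum>i<n u. particle (head G ((\<theta> ^^ i) (\<rho> u))) v - particle u v)"

definition fire :: "('v \<Rightarrow> nat) \<Rightarrow> ('v, 'a) rp_config \<Rightarrow> ('v, 'a) rp_config" where
  "fire n = (\<lambda>(\<rho>, \<sigma>). (fire_rotors n \<rho>, \<lambda>v. \<sigma> v + gain n \<rho> v))"

lemma fire_rotors_add: "fire_rotors (\<lambda>u. n u + m u) \<rho> = fire_rotors n (fire_rotors m \<rho>)"
  by (auto simp: fire_rotors_def fun_eq_iff funpow_add)

lemma gain_add: "gain (\<lambda>u. n u + m u) \<rho> v = gain m \<rho> v + gain n (fire_rotors m \<rho>) v"
proof -
  \<comment> \<open>The \<open>b\<close> firings come first; the other \<open>a\<close> firings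
    continue from the \<open>b\<close>-th rotor, hence the shift by \<open>b\<close>.\<close>
  have sum_lessThan_add: "(\<Sum>i<a + b. f i) = (\<Sum>i<b. f i) + (\<Sum>i<a. f (i + b))"
    for a b and f :: "nat \<Rightarrow> int"
    by (induction a) (simp_all add: add.assoc)
  show ?thesis
    unfolding gain_def sum.distrib[symmetric]
  proof (rule sum.cong[OF refl])
    fix u assume "u \<in> nonsinks G"
    then have "(\<theta> ^^ i) (fire_rotors m \<rho> u) = (\<theta> ^^ (i + m u)) (\<rho> u)" for i
      unfolding fire_rotors_def funpow_add by simp
    then show "(\<Sum>i<n u + m u. particle (head G ((\<theta> ^^ i) (\<rho> u))) v - particle u v) =
        (\<Sum>i<m u. particle (head G ((\<theta> ^^ i) (\<rho> u))) v - particle u v) +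
        (\<Sum>i<n u. particle (head G ((\<theta> ^^ i) (fire_rotors m \<rho> u))) v - particle u v)"
      by (simp only: sum_lessThan_add)
  qed
qed

lemma fire_add: "fire (\<lambda>u. n u + m u) s = fire n (fire m s)"
  by (cases s) (simp add: fire_def fire_rotors_add gain_add add.assoc)

lemma fire_commute: "fire n (fire m s) = fire m (fire n s)"
  by (simp only: fire_add[symmetric] add.commute)

lemma theta_funpow_out_arcs:
  "u \<in> nonsinks G \<Longrightarrow> a \<in> out_arcs G u \<Longrightarrow> (\<theta> ^^ i) a \<in> out_arcs G u"
  by (rule funpow_in) (use theta_out_arcs in blast)

lemma fire_rotors_config:
  assumes "\<rho> \<in> rotor_configs G"
  shows "fire_rotors n \<rho> \<in> rotor_configs G"
proof -
  have "fire_rotors n \<rho> u \<in> out_arcs G u" if "u \<in> nonsinks G" for u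
    unfolding fire_rotors_def using that theta_funpow_out_arcs config_in[OF assms] by presburger
  then show ?thesis
    using assms by (auto simp: rotor_configs_def PiE_def extensional_def fire_rotors_def)
qed

lemma inj_theta_funpow: "inj (\<theta> ^^ i)"
  using theta_perm by (induction i) (auto simp: permutes_inj inj_compose)

text \<open>Rotors cancel because powers of \<open>\<theta>\<close> are injective; the gains then
  coincide and cancel too.\<close>

lemma fire_inject:
  assumes "fire n (\<rho>, \<sigma>) = fire n (\<rho>', \<sigma>')"
  shows "\<rho> = \<rho>' \<and> \<sigma> = \<sigma>'"
proof -
  have eq: "fire_rotors n \<rho> u = fire_rotors n \<rho>' u" "\<sigma> u + gain n \<rho> u = \<sigma>' u + gain n \<rho>' u" for u
    using assms by (auto simp: fire_def fun_eq_iff)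
  have "\<rho> = \<rho>'"
  proof
    fix u show "\<rho> u = \<rho>' u"
      using eq(1)[of u] inj_theta_funpow by (auto simp: fire_rotors_def inj_eq split: if_splits)
  qed
  with eq(2) show ?thesis by (simp add: fun_eq_iff)
qed

lemma fire_0: "fire (\<lambda>u. 0) s = s"
  by (cases s) (simp add: fire_def fire_rotors_def gain_def fun_eq_iff)

lemma fire_single:
  assumes u: "u \<in> nonsinks G" and s: "s \<in> rp_configs G"
  shows "fire (\<lambda>w. if w = u then k else 0) s = (routing_pos G \<theta> u ^^ k) s"
proof (induction k)
  case 0
  then show ?case by (simp add: fire_0)
next
  case (Suc k)
  have one: "fire (\<lambda>w. if w = u then 1 else 0) t = routing_pos G \<theta> u t" if "t \<in> rp_configs G" for t
  proof -
    obtain \<rho> \<sigma> where t: "t = (\<rho>, \<sigma>)" "\<rho> \<in> rotor_configs G"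
      using \<open>t \<in> rp_configs G\<close> by (cases t) (auto simp: rp_configs_def)
    have "gain (\<lambda>w. if w = u then 1 else 0) \<rho> v = particle (head G (\<rho> u)) v - particle u v" for v
    proof -
      have "gain (\<lambda>w. if w = u then 1 else 0) \<rho> v =
          (\<Sum>w\<in>nonsinks G. if w = u then particle (head G (\<rho> u)) v - particle u v else 0)"
        unfolding gain_def by (rule sum.cong) auto
      then show ?thesis using u finite_nonsinks by simp
    qed
    moreover have "fire_rotors (\<lambda>w. if w = u then 1 else 0) \<rho> = \<rho>(u := \<theta> (\<rho> u))"
      using u by (auto simp: fire_rotors_def fun_eq_iff)
    ultimately show ?thesis
      using t u by (simp add: fire_def routing_pos_eq add_diff_eq)
  qed
  have "(\<lambda>w. if w = u then Suc k else 0) =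
      (\<lambda>w. (if w = u then 1 else 0) + (if w = u then k else 0))"
    by auto
  then show ?case
    using Suc one funpow_in[of "rp_configs G" "routing_pos G \<theta> u" s k] s routing_pos_in[OF u]
    by (simp add: fire_add)
qed

section \<open>Integer routings expressed through natural firings\<close>

lemma routing_pos_neg:
  "u \<in> nonsinks G \<Longrightarrow> s \<in> rp_configs G \<Longrightarrow> routing_pos G \<theta> u (routing_neg G \<theta> u s) = s"
  using routing_pos_bij unfolding routing_neg_def by (metis bij_betw_inv_into_right)

lemma funpow_routing_pos_neg:
  assumes u: "u \<in> nonsinks G" and s: "s \<in> rp_configs G"
  shows "(routing_pos G \<theta> u ^^ k) ((routing_neg G \<theta> u ^^ k) s) = s"
proof (induction k)
  case (Suc k)
  have "(routing_neg G \<theta> u ^^ k) s \<in> rp_configs G"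
    using s u by (intro funpow_in routing_neg_in)
  then have "routing_pos G \<theta> u ((routing_neg G \<theta> u ^^ Suc k) s) = (routing_neg G \<theta> u ^^ k) s"
    using routing_pos_neg[OF u] by simp
  then show ?case
    using Suc by (simp only: funpow_Suc_right comp_apply)
qed simp

text \<open>Routing \<open>m\<close> more times clears the negative part of the exponent. For
  \<open>m > n\<close>, the inverse steps cancel against \<open>m - n\<close> of the positive
  ones.\<close>

lemma routing_pos_power:
  assumes u: "u \<in> nonsinks G" and s: "s \<in> rp_configs G"
  shows "(routing_pos G \<theta> u ^^ m) (routing_power G \<theta> u (int n - int m) s) =
    (routing_pos G \<theta> u ^^ n) s"
proof (cases "m \<le> n")
  case True
  then have "nat (int n - int m) = n - m" by auto
  then have "(routing_pos G \<theta> u ^^ m) (routing_power G \<theta> u (int n - int m) s) =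
      (routing_pos G \<theta> u ^^ (m + (n - m))) s"
    unfolding funpow_add using True by (simp add: routing_power_def)
  with True show ?thesis by simp
next
  case False
  let ?d = "m - n"
  have d: "nat (- (int n - int m)) = ?d" by auto
  have "(routing_pos G \<theta> u ^^ m) t = (routing_pos G \<theta> u ^^ n) ((routing_pos G \<theta> u ^^ ?d) t)" for t
    using False by (metis comp_apply funpow_add le_add_diff_inverse nat_le_linear)
  then show ?thesis
    using False funpow_routing_pos_neg[OF u s, of ?d] unfolding routing_power_def d by simp
qed

text \<open>The bridge from the fold with inverses to natural vectors: with
  \<open>fire_inject\<close>, a routing by \<open>n - m\<close> is determined by the two firings
  \<open>n\<close> and \<open>m\<close>.\<close>

lemma fire_routing:
  assumes s: "s \<in> rp_configs G"
  shows "fire m (routing G \<theta> (\<lambda>u. int (n u) - int (m u)) s) = fire n s"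
proof -
  let ?r = "\<lambda>u. int (n u) - int (m u)"
  \<comment> \<open>Vectors are cut off outside \<open>A\<close>, so that the claim can be proved
    vertex by vertex along the fold.\<close>
  let ?on = "\<lambda>n A w. if w \<in> A then n w else (0::nat)"
  let ?fold = "\<lambda>A. Finite_Set.fold (\<lambda>u. routing_power G \<theta> u (?r u)) s A"
  have on: "?on k (insert u A) = (\<lambda>w. ?on k A w + (if w = u then k u else 0))"
    if "u \<notin> A" for k :: "'v \<Rightarrow> nat" and u A
    using that by auto
  have "?fold A \<in> rp_configs G \<and> fire (?on m A) (?fold A) = fire (?on n A) s"
    if "A \<subseteq> nonsinks G" for A
    using finite_subset[OF that finite_nonsinks] that
  proof (induction A)
    case empty
    then show ?case using s by simp
  next
    case (insert u A)
    let ?X = "?fold A" and ?Y = "routing_power G \<theta> u (?r u) (?fold A)"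
    have u: "u \<in> nonsinks G" and X: "?X \<in> rp_configs G"
      and IH: "fire (?on m A) ?X = fire (?on n A) s"
      using insert by auto
    have Y: "?Y \<in> rp_configs G" using routing_power_in[OF u X] .
    have "fire (?on m (insert u A)) ?Y = fire (?on m A) ((routing_pos G \<theta> u ^^ m u) ?Y)"
      by (simp only: on[OF insert(2)] fire_add fire_single[OF u Y])
    also have "\<dots> = fire (?on m A) (fire (\<lambda>w. if w = u then n u else 0) ?X)"
      by (simp only: routing_pos_power[OF u X] fire_single[OF u X])
    also have "\<dots> = fire (\<lambda>w. if w = u then n u else 0) (fire (?on n A) s)"
      by (simp only: fire_commute[of "?on m A"] IH)
    also have "\<dots> = fire (?on n (insert u A)) s"
      by (simp only: on[OF insert(2)] fire_add fire_commute)
    finally show ?case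
      using routing_fold_insert[OF insert(1) insert(4) insert(2) s, of ?r] Y by simp
  qed
  from this[of "nonsinks G"]
  have "fire (?on m (nonsinks G)) (routing G \<theta> ?r s) = fire (?on n (nonsinks G)) s"
    by (simp add: routing_def)
  \<comment> \<open>Values outside the non-sinks do not enter \<open>fire\<close>, so the cut-off is
    harmless at the end.\<close>
  moreover have "fire (?on k (nonsinks G)) = fire k" for k
    by (auto simp: fire_def fun_eq_iff fire_rotors_def gain_def)
  ultimately show ?thesis by simp
qed

section \<open>Balanced pairs of routing vectors\<close>

definition balanced :: "('v \<Rightarrow> nat) \<Rightarrow> ('v \<Rightarrow> nat) \<Rightarrow> ('v \<Rightarrow> 'a) \<Rightarrow> ('v \<Rightarrow> 'a) \<Rightarrow> bool" where
  "balanced n m \<rho> \<rho>' \<longleftrightarrow>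
     fire_rotors n \<rho> = fire_rotors m \<rho>' \<and> (\<forall>v. gain n \<rho> v = gain m \<rho>' v)"

lemma balanced_sym: "balanced n m \<rho> \<rho>' \<Longrightarrow> balanced m n \<rho>' \<rho>"
  by (simp add: balanced_def)

lemma balanced_iff_fire: "balanced n m \<rho> \<rho>' \<longleftrightarrow> fire n (\<rho>, \<sigma>) = fire m (\<rho>', \<sigma>)"
  by (auto simp: balanced_def fire_def fun_eq_iff)

text \<open>Firing \<open>n'\<close> after \<open>n\<close> and \<open>m\<close> after
  \<open>m'\<close> closes the diamond, since firings commute. Disjointness of supports may be lost
  here.\<close>

lemma balanced_trans:
  assumes "balanced n m \<rho>1 \<rho>2" "balanced n' m' \<rho>2 \<rho>3"
  shows "balanced (\<lambda>u. n' u + n u) (\<lambda>u. m u + m' u) \<rho>1 \<rho>3"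
proof -
  let ?s = "\<lambda>\<rho>. (\<rho>, \<lambda>v. 0 :: int)"
  have "fire n' (fire n (?s \<rho>1)) = fire m (fire n' (?s \<rho>2))"
    using assms(1) fire_commute[of n' m] by (simp add: balanced_iff_fire[where \<sigma> = "\<lambda>v. 0"])
  also have "\<dots> = fire m (fire m' (?s \<rho>3))"
    using assms(2) by (simp add: balanced_iff_fire[where \<sigma> = "\<lambda>v. 0"])
  finally show ?thesis
    by (simp only: balanced_iff_fire[where \<sigma> = "\<lambda>v. 0"] fire_add)
qed

lemma rotor_equiv_disjoint_balanced:
  assumes "rotor_equiv G \<theta> \<rho> \<rho>'"
  obtains n m where "balanced n m \<rho> \<rho>'" "\<And>u. n u = 0 \<or> m u = 0"
proof -
  obtain \<sigma> r where s: "(\<rho>, \<sigma>) \<in> rp_configs G" "routing G \<theta> r (\<rho>, \<sigma>) = (\<rho>', \<sigma>)"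
    using assms by (auto simp: rotor_equiv_def rp_equiv_def)
  \<comment> \<open>The positive and negative parts of \<open>r\<close>, which have disjoint
    supports.\<close>
  let ?n = "\<lambda>u. nat (r u)" and ?m = "\<lambda>u. nat (- r u)"
  have "(\<lambda>u. int (?n u) - int (?m u)) = r" by auto
  then have "balanced ?n ?m \<rho> \<rho>'"
    using fire_routing[OF s(1), of ?m ?n] s(2) by (simp only: balanced_iff_fire[where \<sigma> = \<sigma>])
  moreover have "?n u = 0 \<or> ?m u = 0" for u by auto
  ultimately show thesis using that by blast
qed

lemma balanced_rotor_equiv:
  assumes \<rho>: "\<rho> \<in> rotor_configs G" "\<rho>' \<in> rotor_configs G" and b: "balanced n m \<rho> \<rho>'"
  shows "rotor_equiv G \<theta> \<rho> \<rho>'"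
proof -
  let ?\<sigma> = "\<lambda>v. 0 :: int" and ?r = "\<lambda>u. int (n u) - int (m u)"
  have \<sigma>: "?\<sigma> \<in> particle_configs G" by (simp add: particle_configs_def)
  then have s: "(\<rho>, ?\<sigma>) \<in> rp_configs G" "(\<rho>', ?\<sigma>) \<in> rp_configs G"
    using \<rho> by (auto simp: rp_configs_def)
  have "fire m (routing G \<theta> ?r (\<rho>, ?\<sigma>)) = fire m (\<rho>', ?\<sigma>)"
    using fire_routing[OF s(1)] b balanced_iff_fire by metis
  then have "routing G \<theta> ?r (\<rho>, ?\<sigma>) = (\<rho>', ?\<sigma>)"
    using fire_inject by (metis surj_pair)
  then show ?thesis using \<sigma> s by (auto simp: rotor_equiv_def rp_equiv_def)
qed

lemma head_in_support:
  assumes b: "balanced n m \<rho> \<rho>'" and disj: "\<And>u. n u = 0 \<or> m u = 0"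
    and U: "U = {u \<in> nonsinks G. n u > 0}" and u: "u \<in> U"
  shows "head G (\<rho> u) \<in> U"
proof -
  have finU: "finite U" using U finite_nonsinks by simp
  have sum_particle: "(\<Sum>v\<in>U. particle x v) = (if x \<in> U then 1 else 0)" for x
    using finU by (simp add: particle_def)
  \<comment> \<open>\<open>g k \<tau> w\<close> is the net number of particles that the
    \<open>k w\<close> firings of \<open>w\<close> bring into \<open>U\<close>.\<close>
  define g where "g k \<tau> w = (\<Sum>i<k w. (if head G ((\<theta> ^^ i) (\<tau> w)) \<in> U then 1 else 0) -
      (if w \<in> U then 1 else 0 :: int))" for k :: "'v \<Rightarrow> nat" and \<tau> w
  have sum_gain: "(\<Sum>v\<in>U. gain k \<tau> v) = (\<Sum>w\<in>nonsinks G. g k \<tau> w)" for k \<tau>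
    unfolding gain_def g_def
    by (subst sum.swap, rule sum.cong[OF refl], subst sum.swap)
      (simp add: sum_subtractf sum_particle)
  \<comment> \<open>A vertex fired by \<open>n\<close> lies in \<open>U\<close>, so each firing
    removes a particle from \<open>U\<close> and brings back at most one.\<close>
  have le: "g n \<rho> w \<le> 0" if "w \<in> nonsinks G" for w
    using that U unfolding g_def by (intro sum_nonpos) auto
  \<comment> \<open>By disjointness a vertex fired by \<open>m\<close> lies outside
    \<open>U\<close>, so no particle is taken from \<open>U\<close>.\<close>
  have ge: "g m \<rho>' w \<ge> 0" if "w \<in> nonsinks G" for w
    using that U disj[of w] unfolding g_def by (intro sum_nonneg) auto
  have "(\<Sum>w\<in>nonsinks G. g n \<rho> w) = (\<Sum>w\<in>nonsinks G. g m \<rho>' w)"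
    using b by (simp add: balanced_def flip: sum_gain)
  then have "(\<Sum>w\<in>nonsinks G. - g n \<rho> w) = 0"
    using sum_nonpos[of "nonsinks G" "g n \<rho>", OF le] sum_nonneg[of "nonsinks G" "g m \<rho>'", OF ge]
    by (simp add: sum_negf)
  then have "- g n \<rho> u = 0"
    using sum_nonneg_0[OF finite_nonsinks, of "\<lambda>w. - g n \<rho> w" u] le u U by auto
  then have "(\<Sum>i<n u. 1 - (if head G ((\<theta> ^^ i) (\<rho> u)) \<in> U then 1 else 0 :: int)) = 0"
    using u by (simp add: g_def sum_subtractf)
  \<comment> \<open>The nonnegative terms sum to zero, so each vanishes. The term
    \<open>i = 0\<close> exists because \<open>n u > 0\<close>, and it concerns the current rotor
    \<open>\<rho> u\<close>.\<close>
  then have "1 - (if head G ((\<theta> ^^ 0) (\<rho> u)) \<in> U then 1 else 0 :: int) = 0"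
    by (rule sum_nonneg_0[rotated 2]) (use u U in auto)
  then show ?thesis by (simp split: if_splits)
qed

section \<open>Cycle pushes\<close>

text \<open>\<open>\<theta>\<close> preserves tails, so arcs leaving \<open>C\<close> and the other
  arcs do not mix. Injectivity gives meaning to the \<open>inv\<close> in negative pushes.\<close>

lemma inj_theta_on: "inj (theta_on G \<theta> C)"
proof (rule injI)
  fix a b assume eq: "theta_on G \<theta> C a = theta_on G \<theta> C b"
  have "\<theta> c \<in> arcs G \<and> tail G (\<theta> c) = tail G c" if "c \<in> arcs G" for c
  proof -
    have "tail G c \<in> nonsinks G" "c \<in> out_arcs G (tail G c)"
      using that by (auto simp: nonsinks_def out_arcs_def)
    then have "\<theta> c \<in> out_arcs G (tail G c)" using theta_out_arcs by blast
    then show ?thesis by auto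
  qed
  then show "a = b"
    using eq permutes_inj[OF theta_perm] by (auto simp: theta_on_def inj_eq split: if_splits)
qed

lemma compose_theta_on:
  assumes "\<rho> \<in> rotor_configs G"
  shows "compose (nonsinks G) (theta_on G \<theta> C) \<rho> = fire_rotors (\<lambda>u. if u \<in> C then 1 else 0) \<rho>"
proof
  fix u show "compose (nonsinks G) (theta_on G \<theta> C) \<rho> u = fire_rotors (\<lambda>u. if u \<in> C then 1 else 0) \<rho> u"
    using assms tail_config[OF assms]
    by (auto simp: compose_def fire_rotors_def theta_on_def rotor_configs_def PiE_def extensional_def)
qed

lemma inv_theta_on:
  assumes u: "u \<in> nonsinks G" and a: "a \<in> out_arcs G u"
  shows "inv (theta_on G \<theta> C) a = (if u \<in> C then inv \<theta> a else a)"
proof -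
  have "theta_on G \<theta> C (if u \<in> C then inv \<theta> a else a) = a"
    using a inv_theta_out_arcs[OF u a] permutes_inverses[OF theta_perm] by (auto simp: theta_on_def)
  then show ?thesis using inj_theta_on by (rule inv_f_eq[rotated])
qed

lemma positive_push_fire_rotors:
  assumes "\<rho> \<in> rotor_configs G"
  shows "positive_push G \<theta> \<rho> \<rho>' \<longleftrightarrow> (\<exists>C. circuit_vertices (config_graph G \<rho>) C \<and>
    \<rho>' = fire_rotors (\<lambda>u. if u \<in> C then 1 else 0) \<rho>)"
  using assms by (simp add: positive_push_def compose_theta_on)

lemma compose_inv_theta_config:
  assumes "\<rho> \<in> rotor_configs G"
  shows "compose (nonsinks G) (inv \<theta>) \<rho> \<in> rotor_configs G"
proof -
  have "inv \<theta> (\<rho> u) \<in> out_arcs G u" if "u \<in> nonsinks G" for u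
    using inv_theta_out_arcs[OF that config_in[OF assms that]] .
  then show ?thesis by (auto simp: rotor_configs_def compose_def)
qed

lemma compose_inv_theta_on_config:
  assumes "\<rho> \<in> rotor_configs G"
  shows "compose (nonsinks G) (inv (theta_on G \<theta> C)) \<rho> \<in> rotor_configs G"
proof -
  have "inv (theta_on G \<theta> C) (\<rho> u) \<in> out_arcs G u" if "u \<in> nonsinks G" for u
    using inv_theta_out_arcs[OF that config_in[OF assms that]] config_in[OF assms that]
    unfolding inv_theta_on[OF that config_in[OF assms that]] by presburger
  then show ?thesis by (auto simp: rotor_configs_def compose_def)
qed

text \<open>The same \<open>C\<close> serves both ways: turning the rotors of \<open>C\<close> back
  recovers \<open>\<rho>\<close> on \<open>C\<close>, and a circuit condition depends only on the
  rotors of \<open>C\<close>. Negative pushes thus reduce to positive ones.\<close>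

lemma negative_push_converse:
  assumes \<rho>: "\<rho> \<in> rotor_configs G" and \<rho>': "\<rho>' \<in> rotor_configs G"
  shows "negative_push G \<theta> \<rho>' \<rho> \<longleftrightarrow> positive_push G \<theta> \<rho> \<rho>'"
proof -
  let ?c = "compose (nonsinks G)"
  have th_inv: "\<theta> (inv \<theta> a) = a" "inv \<theta> (\<theta> a) = a" for a
    using permutes_inverses[OF theta_perm] by auto
  have und: "\<rho> u = undefined" "\<rho>' u = undefined" if "u \<notin> nonsinks G" for u
    using that \<rho> \<rho>' by (auto simp: rotor_configs_def)
  have inverse: "\<rho> = ?c (inv (theta_on G \<theta> C)) \<rho>' \<longleftrightarrow> \<rho>' = ?c (theta_on G \<theta> C) \<rho>" for C
    unfolding compose_theta_on[OF \<rho>] fun_eq_iff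
    by (rule iff_allI)
      (auto simp: compose_def fire_rotors_def inv_theta_on[OF _ config_in[OF \<rho>']] th_inv und)
  have "circuit_vertices (config_graph G (?c (inv \<theta>) \<rho>')) C \<longleftrightarrow>
      circuit_vertices (config_graph G \<rho>) C"
    if eq: "\<rho>' = ?c (theta_on G \<theta> C) \<rho>" for C
  proof -
    \<comment> \<open>Outside \<open>C\<close> the two configurations may differ, since there
      \<open>inv \<theta>\<close> is applied to an unturned rotor.\<close>
    have agree: "?c (inv \<theta>) \<rho>' u = \<rho> u" if "u \<in> C" "u \<in> nonsinks G" for u
      using that unfolding eq compose_theta_on[OF \<rho>] by (simp add: compose_def fire_rotors_def th_inv)
    have c: "?c (inv \<theta>) \<rho>' \<in> rotor_configs G" using compose_inv_theta_config[OF \<rho>'] .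
    show ?thesis
      using circuit_vertices_transfer[OF c, of C \<rho>] circuit_vertices_transfer[OF \<rho>, of C "?c (inv \<theta>) \<rho>'"]
        circuit_vertices_subset[OF c, of C] circuit_vertices_subset[OF \<rho>, of C] agree
      by (metis subsetD)
  qed
  then show ?thesis unfolding negative_push_def positive_push_def inverse by auto
qed

lemma cycle_push_config:
  assumes "cycle_push G \<theta> \<rho> \<rho>'" "\<rho> \<in> rotor_configs G"
  shows "\<rho>' \<in> rotor_configs G"
  using assms compose_inv_theta_on_config[OF assms(2)] fire_rotors_config[OF assms(2)]
  by (auto simp: cycle_push_def positive_push_fire_rotors negative_push_def)

lemma cycle_push_sym:
  assumes "cycle_push G \<theta> \<rho> \<rho>'" "\<rho> \<in> rotor_configs G"
  shows "cycle_push G \<theta> \<rho>' \<rho>"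
  using assms(1) negative_push_converse[OF assms(2) cycle_push_config[OF assms]]
    negative_push_converse[OF cycle_push_config[OF assms] assms(2)]
  by (auto simp: cycle_push_def)

text \<open>Each vertex of the circuit passes one particle to its successor and receives one from
  its predecessor.\<close>

lemma gain_circuit:
  assumes \<rho>: "\<rho> \<in> rotor_configs G" and C: "circuit_vertices (config_graph G \<rho>) C"
  shows "gain (\<lambda>u. if u \<in> C then 1 else 0) \<rho> v = 0"
proof -
  have sub: "C \<subseteq> nonsinks G" using circuit_vertices_subset[OF \<rho> C] .
  have "gain (\<lambda>u. if u \<in> C then 1 else 0) \<rho> v =
      (\<Sum>u\<in>nonsinks G. if u \<in> C then particle (head G (\<rho> u)) v - particle u v else 0)"
    unfolding gain_def by (rule sum.cong) auto
  also have "\<dots> = (\<Sum>u\<in>C. particle (head G (\<rho> u)) v - particle u v)"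
    using sub by (simp add: sum.inter_restrict[OF finite_nonsinks, symmetric] Int_absorb1)
  also have "\<dots> = 0"
    using circuit_vertices_sum_head[OF \<rho> C, of "\<lambda>u. particle u v"] by (simp add: sum_subtractf)
  finally show ?thesis .
qed

section \<open>The two directions of the equivalence\<close>

lemma positive_push_balanced:
  assumes \<rho>: "\<rho> \<in> rotor_configs G" and p: "positive_push G \<theta> \<rho> \<rho>'"
  shows "\<exists>n m. balanced n m \<rho> \<rho>'"
proof -
  obtain C where C: "circuit_vertices (config_graph G \<rho>) C"
      "\<rho>' = fire_rotors (\<lambda>u. if u \<in> C then 1 else 0) \<rho>"
    using p positive_push_fire_rotors[OF \<rho>] by auto
  have "balanced (\<lambda>u. if u \<in> C then 1 else 0) (\<lambda>u. 0) \<rho> \<rho>'"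
    unfolding balanced_def C(2) gain_circuit[OF \<rho> C(1)]
    by (simp add: fire_rotors_def gain_def fun_eq_iff)
  then show ?thesis by blast
qed

lemma cycle_pushes_balanced:
  assumes "(cycle_push G \<theta>)\<^sup>*\<^sup>* \<rho> \<rho>'" "\<rho> \<in> rotor_configs G"
  shows "\<rho>' \<in> rotor_configs G \<and> (\<exists>n m. balanced n m \<rho> \<rho>')"
  using assms
proof (induction rule: rtranclp_induct)
  case base
  then show ?case by (auto simp: balanced_def)
next
  case (step \<rho>1 \<rho>2)
  then have \<rho>1: "\<rho>1 \<in> rotor_configs G" by simp
  have \<rho>2: "\<rho>2 \<in> rotor_configs G" using cycle_push_config step(2) \<rho>1 by blast
  \<comment> \<open>A negative push is a positive push read backwards, and balance is
    symmetric.\<close>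
  have "\<exists>n m. balanced n m \<rho>1 \<rho>2"
    using step(2) positive_push_balanced[OF \<rho>1] positive_push_balanced[OF \<rho>2]
      negative_push_converse[OF \<rho>2 \<rho>1] balanced_sym
    unfolding cycle_push_def by blast
  then show ?case using step \<rho>2 balanced_trans by blast
qed

text \<open>The descent step. Splitting the circuit off \<open>n\<close> leaves the balance intact
  because its gain is zero, and the supports stay disjoint because \<open>n1\<close> is at most
  \<open>n\<close>.\<close>

lemma balanced_reduce:
  assumes \<rho>: "\<rho> \<in> rotor_configs G" and b: "balanced n m \<rho> \<rho>'"
    and disj: "\<And>u. n u = 0 \<or> m u = 0" and u: "u \<in> nonsinks G" "n u > 0"
  obtains \<rho>1 n1 where "positive_push G \<theta> \<rho> \<rho>1" "balanced n1 m \<rho>1 \<rho>'" "\<And>w. n1 w = 0 \<or> m w = 0"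
    "sum n1 (nonsinks G) < sum n (nonsinks G)"
proof -
  define U where "U = {u \<in> nonsinks G. n u > 0}"
  have "U \<subseteq> nonsinks G" "U \<noteq> {}" using u by (auto simp: U_def)
  then obtain C where C: "C \<noteq> {}" "C \<subseteq> U" "circuit_vertices (config_graph G \<rho>) C"
    using ex_circuit_vertices[OF \<rho>] head_in_support[OF b disj U_def] by metis
  define c where "c = (\<lambda>u. if u \<in> C then 1 else 0 :: nat)"
  define n1 where "n1 = (\<lambda>u. n u - c u)"
  \<comment> \<open>The subtraction is not truncated: \<open>n\<close> is positive on
    \<open>C\<close>, as \<open>C \<subseteq> U\<close>.\<close>
  have n: "n = (\<lambda>u. n1 u + c u)"
    using C(2) by (auto simp: n1_def c_def U_def fun_eq_iff)
  have "balanced n1 m (fire_rotors c \<rho>) \<rho>'"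
    using b gain_circuit[OF \<rho> C(3)] unfolding balanced_def n fire_rotors_add gain_add
    by (simp add: c_def)
  moreover have "positive_push G \<theta> \<rho> (fire_rotors c \<rho>)"
    using positive_push_fire_rotors[OF \<rho>] C(3) by (auto simp: c_def)
  moreover have "n1 w = 0 \<or> m w = 0" for w using disj[of w] by (auto simp: n1_def)
  moreover obtain x where x: "x \<in> C" using C(1) by blast
  have "sum n1 (nonsinks G) < sum n (nonsinks G)"
    by (rule sum_strict_mono_ex1)
      (use finite_nonsinks x C(2) in \<open>auto simp: n1_def c_def U_def intro!: bexI[of _ x]\<close>)
  ultimately show thesis using that by blast
qed

lemma balanced_cycle_pushes:
  assumes "\<rho> \<in> rotor_configs G" "\<rho>' \<in> rotor_configs G" "balanced n m \<rho> \<rho>'"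
    and "\<And>u. n u = 0 \<or> m u = 0"
  shows "(cycle_push G \<theta>)\<^sup>*\<^sup>* \<rho> \<rho>'"
  using assms
\<comment> \<open>Induction on the total number of firings on both sides; both configurations vary,
  as a push may be made from either end.\<close>
proof (induction "sum n (nonsinks G) + sum m (nonsinks G)" arbitrary: n m \<rho> \<rho>' rule: less_induct)
  case less
  consider (n) u where "u \<in> nonsinks G" "n u > 0" | (m) u where "u \<in> nonsinks G" "m u > 0"
    | (zero) "\<And>u. u \<in> nonsinks G \<Longrightarrow> n u = 0 \<and> m u = 0"
    by blast
  then show ?case
  proof cases
    case n
    obtain \<rho>1 n1 where 1: "positive_push G \<theta> \<rho> \<rho>1" "balanced n1 m \<rho>1 \<rho>'" "\<And>w. n1 w = 0 \<or> m w = 0"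
        "sum n1 (nonsinks G) < sum n (nonsinks G)"
      using balanced_reduce[OF less(2,4,5) n] by blast
    have push: "cycle_push G \<theta> \<rho> \<rho>1" using 1(1) by (simp add: cycle_push_def)
    have "(cycle_push G \<theta>)\<^sup>*\<^sup>* \<rho>1 \<rho>'"
      using less(1)[of n1 m \<rho>1 \<rho>'] 1 less(3) cycle_push_config[OF push less(2)] by simp
    with push show ?thesis by (rule converse_rtranclp_into_rtranclp)
  next
    case m
    have disj: "m u = 0 \<or> n u = 0" for u using less(5)[of u] by (simp only: disj_commute)
    obtain \<rho>1 m1 where 1: "positive_push G \<theta> \<rho>' \<rho>1" "balanced m1 n \<rho>1 \<rho>" "\<And>w. m1 w = 0 \<or> n w = 0"
        "sum m1 (nonsinks G) < sum m (nonsinks G)"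
      using balanced_reduce[OF less(3) balanced_sym[OF less(4)] disj m] by blast
    have push: "cycle_push G \<theta> \<rho>' \<rho>1" using 1(1) by (simp add: cycle_push_def)
    have disj1: "n w = 0 \<or> m1 w = 0" for w using 1(3)[of w] by (simp only: disj_commute)
    have "(cycle_push G \<theta>)\<^sup>*\<^sup>* \<rho> \<rho>1"
      using less(1)[of n m1 \<rho> \<rho>1] balanced_sym[OF 1(2)] 1(4) disj1 less(2)
        cycle_push_config[OF push less(3)] by simp
    \<comment> \<open>The push was made from \<open>\<rho>'\<close>, so it is reversed to become the
      last step of the sequence.\<close>
    with cycle_push_sym[OF push less(3)] show ?thesis by (simp add: rtranclp.rtrancl_into_rtrancl)
  next
    case zero
    have "fire_rotors n \<rho> = \<rho>" "fire_rotors m \<rho>' = \<rho>'"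
      using zero by (auto simp: fire_rotors_def fun_eq_iff)
    then have "\<rho> = \<rho>'" using less(4) by (simp add: balanced_def)
    then show ?thesis by simp
  qed
qed

end

theorem theorem1:
  fixes G :: "('v, 'a) pre_digraph" and \<theta> :: "'a \<Rightarrow> 'a"
    and \<rho> \<rho>' :: "'v \<Rightarrow> 'a"
  assumes "rotor_graph G \<theta>"
    and "\<rho> \<in> rotor_configs G"
    and "\<rho>' \<in> rotor_configs G"
  shows "rotor_equiv G \<theta> \<rho> \<rho>' \<longleftrightarrow> (cycle_push G \<theta>)\<^sup>*\<^sup>* \<rho> \<rho>'"
proof -
  interpret rotor_graph G \<theta> by fact
  show ?thesis
  proof
    assume "rotor_equiv G \<theta> \<rho> \<rho>'"
    then obtain n m where "balanced n m \<rho> \<rho>'" "\<And>u. n u = 0 \<or> m u = 0"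
      using rotor_equiv_disjoint_balanced by blast
    then show "(cycle_push G \<theta>)\<^sup>*\<^sup>* \<rho> \<rho>'"
      using balanced_cycle_pushes assms(2,3) by blast
  next
    assume "(cycle_push G \<theta>)\<^sup>*\<^sup>* \<rho> \<rho>'"
    then show "rotor_equiv G \<theta> \<rho> \<rho>'"
      using cycle_pushes_balanced balanced_rotor_equiv assms(2,3) by blast
  qed
qed

end
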